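(* Let $L=\mathbb{N}\cup\{\omega,\dagger\}$ and let $<$ be a well-founded partial order on $L$ extending the usual order of the ordinals $\le\omega$ on $\mathbb{N}\cup\{\omega\}$. Let $\to_{\mathit{BH}}$ be the Buchholz Hydra rewrite relation and let $\rightsquigarrow$ be the rewrite relation induced by the system $\mathit{Star}$ over the signature $L$ (with precedence $>$) on trees. Then ${\to_{\mathit{BH}}}\not\subseteq{\rightsquigarrow^*}$.
   Context: Trees are finite, rooted, unordered; $n(t_1,\ldots,t_k)$ ($k\ge 0$) is the tree with root label $n$ and immediate subtrees $t_1,\ldots,t_k$ (order irrelevant), written $n$ if $k=0$. Buchholz Hydra: a finite tree with nodes labeled from $L=\mathbb{N}\cup\{\omega,\dagger\}$, where (1) $\dagger$ labels only the root, (2) every node directly below the root is labeled $0$, and (3) every remaining node is labeled with an ordinal $\alpha\le\omega$. The relation $\to_{\mathit{BH}}$ is given by the following rules, applied anywhere in the Hydra: (BH$_1$) $x(\vec t_1,\alpha(\vec t_2,0))\to x(\vec t_1,\underbrace{\alpha(\vec t_2),\ldots,\alpha(\vec t_2)}_{k\text{ times}})$ for any $x,\alpha\in L$ and $k\in\mathbb{N}$. (BH$_2$) For a leaf node $x$ labeled with $\alpha$, $0<\alpha<\omega$, find the closest ancestor $y$ of $x$ with $\mathrm{label}(y)\le\alpha$ (it exists by (2)). Let $T'$ be the copy of the subtree rooted at $y$ in which the label of $y$ is changed to $\alpha-1$ and the label of $x$ is changed to $0$. Then the rule is $z(\vec t,\alpha)\to z(\vec t,T')$ for any $z\in L$, where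 the displayed $\alpha$ is the leaf $x$ (i.e. the leaf $x$ is replaced by $T'$). (BH$_3$) $z(\vec t,\omega)\to z(\vec t,k)$ for any $z\in L$ and $k\in\mathbb{N}$, where $\omega$ and $k$ are leaves. Star system: let $L^\star=\{f^\star\mid f\in L\}$ be a set of fresh symbols. $\rightsquigarrow$ is the rewrite relation on trees labeled over $L\cup L^\star$ given by the following rules (applicable at any subtree), for all $f,g\in L$ and finite, possibly empty, vectors $\vec x,\vec y,\vec z$ of trees: (put) $f(\vec x)\rightsquigarrow f^\star(\vec x)$; (select) $f^\star(\vec x,y,\vec z)\rightsquigarrow y$; (copy) $f^\star(\vec x)\rightsquigarrow g(f^\star(\vec x),\ldots,f^\star(\vec x))$ with $0$ or more copies, if $f>g$; (down) $f^\star(\vec x,g(\vec y),\vec z)\rightsquigarrow f(\vec x,g^\star(\vec y),\ldots,g^\star(\vec y),\vec z)$ with $0$ or more copies of $g^\star(\vec y)$. $\rightsquigarrow^*$ is the reflexive-transitive closure of $\rightsquigarrow$. *)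

theory Defs
  imports "HOL-Library.Multiset"
begin

datatype (labels: 'a) tree = Node (root: 'a) (subtrees: "'a tree multiset")

abbreviation leaf :: "'a \<Rightarrow> 'a tree" where
  "leaf a \<equiv> Node a {#}"

text \<open>One-hole contexts are lists of frames, outermost first. A frame consists of the label of a
  node on the path to the hole and the siblings of the next node on that path.\<close>

type_synonym 'a ctxt = "('a \<times> 'a tree multiset) list"

fun fill :: "'a ctxt \<Rightarrow> 'a tree \<Rightarrow> 'a tree" where
  "fill [] t = t"
| "fill ((a, ts) # C) t = Node a (add_mset (fill C t) ts)"

datatype lab = Num nat | Omega | Dagger

text \<open>The usual order of the ordinals up to \<open>\<omega>\<close>; \<open>Dagger\<close> is not an ordinal and is
  related to nothing.\<close>

fun ord_less :: "lab \<Rightarrow> lab \<Rightarrow> bool" where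
  "ord_less (Num m) (Num n) \<longleftrightarrow> m < n"
| "ord_less (Num m) Omega \<longleftrightarrow> True"
| "ord_less _ _ \<longleftrightarrow> False"

definition ord_le :: "lab \<Rightarrow> lab \<Rightarrow> bool" where
  "ord_le a b \<longleftrightarrow> ord_less a b \<or> (a = b \<and> a \<noteq> Dagger)"

definition hydra :: "lab tree \<Rightarrow> bool" where
  "hydra H \<longleftrightarrow> root H = Dagger \<and>
     (\<forall>t \<in># subtrees H. root t = Num 0 \<and> Dagger \<notin> labels t)"

text \<open>In \<open>bh2\<close>, the rewritten leaf has label \<open>\<alpha> = Num (Suc n)\<close> and sits in the hole of
  \<open>C @ (b, ts) # D\<close>. Its closest ancestor with label at most \<open>\<alpha>\<close> is the node with label \<open>b\<close>:
  the labels in \<open>D\<close> are those of the ancestors strictly between the two nodes. The node \<open>z\<close>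
  of the rule is the last one of \<open>(b, ts) # D\<close>, and may thus be the node labelled \<open>b\<close>.\<close>

inductive bh_step :: "lab tree \<Rightarrow> lab tree \<Rightarrow> bool" where
  bh1: "bh_step
      (fill C (Node x (add_mset (Node \<alpha> (add_mset (leaf (Num 0)) ts2)) ts1)))
      (fill C (Node x (replicate_mset k (Node \<alpha> ts2) + ts1)))"
| bh2: "ord_le b (Num (Suc n)) \<Longrightarrow> (\<forall>(d, us) \<in> set D. \<not> ord_le d (Num (Suc n))) \<Longrightarrow>
    bh_step
      (fill (C @ (b, ts) # D) (leaf (Num (Suc n))))
      (fill (C @ (b, ts) # D) (fill ((Num n, ts) # D) (leaf (Num 0))))"
| bh3: "bh_step
      (fill C (Node z (add_mset (leaf Omega) ts)))
      (fill C (Node z (add_mset (leaf (Num k)) ts)))"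

definition BH :: "lab tree rel" where
  "BH = {(s, t). hydra s \<and> bh_step s t}"

datatype 'a starred = Plain 'a | Star 'a

text \<open>The argument \<open>lt\<close> is the precedence: \<open>lt g f\<close> stands for \<open>g < f\<close>.\<close>

inductive star_step :: "('a \<Rightarrow> 'a \<Rightarrow> bool) \<Rightarrow> 'a starred tree \<Rightarrow> 'a starred tree \<Rightarrow> bool"
  for lt :: "'a \<Rightarrow> 'a \<Rightarrow> bool" where
  put: "star_step lt (Node (Plain f) xs) (Node (Star f) xs)"
| select: "star_step lt (Node (Star f) (add_mset y xs)) y"
| copy: "lt g f \<Longrightarrow>
    star_step lt (Node (Star f) xs) (Node (Plain g) (replicate_mset k (Node (Star f) xs)))"
| down: "star_step lt
    (Node (Star f) (add_mset (Node (Plain g) ys) xs))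
    (Node (Plain f) (replicate_mset k (Node (Star g) ys) + xs))"
| subtree: "star_step lt s t \<Longrightarrow> star_step lt (Node h (add_mset s xs)) (Node h (add_mset t xs))"

definition Star_rel :: "('a \<Rightarrow> 'a \<Rightarrow> bool) \<Rightarrow> 'a starred tree rel" where
  "Star_rel lt = {(s, t). star_step lt s t}"

end

(* The hydra rewrites \<dagger>(0(\<omega>(1))) to \<dagger>(0(\<omega>(0(\<omega>(0))))), with two nested \<omega>'s instead of
   one. No rule of Star nests \<omega>'s more deeply, except that copying a starred symbol above \<omega> can
   put \<omega> on top of it. The only candidate for such a symbol is \<dagger>. If \<omega> < \<dagger>, then
   \<dagger> is maximal, so it is never created, and the trees below an occurrence of \<dagger> stay free of
   \<dagger> and keep their nesting of \<omega>'s bounded. *)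

theory Submission imports Defs begin

primrec unstar :: "'a starred \<Rightarrow> 'a" where
  "unstar (Plain a) = a"
| "unstar (Star a) = a"

text \<open>Stars are ignored, so \<open>put\<close> changes nothing. Labels above \<open>m\<close>
  are excluded because \<open>copy\<close> could derive new occurrences of \<open>m\<close> from
  them; labels incomparable to \<open>m\<close> do no harm.\<close>

inductive nesting_le :: "('a \<Rightarrow> 'a \<Rightarrow> bool) \<Rightarrow> 'a \<Rightarrow> nat \<Rightarrow> 'a starred tree \<Rightarrow> bool"
  for lt :: "'a \<Rightarrow> 'a \<Rightarrow> bool" and m :: 'a where
  other: "unstar h \<noteq> m \<Longrightarrow> \<not> lt m (unstar h) \<Longrightarrow> (\<forall>t \<in># ts. nesting_le lt m n t) \<Longrightarrow>
    nesting_le lt m n (Node h ts)"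
| same: "unstar h = m \<Longrightarrow> (\<forall>t \<in># ts. nesting_le lt m n t) \<Longrightarrow>
    nesting_le lt m (Suc n) (Node h ts)"

lemma nesting_le_Node [simp]:
  "nesting_le lt m n (Node h ts) \<longleftrightarrow>
    (if unstar h = m then \<exists>k. n = Suc k \<and> (\<forall>t \<in># ts. nesting_le lt m k t)
     else \<not> lt m (unstar h) \<and> (\<forall>t \<in># ts. nesting_le lt m n t))"
  by (subst nesting_le.simps) auto

lemma nesting_le_Suc: "nesting_le lt m n t \<Longrightarrow> nesting_le lt m (Suc n) t"
  by (induction rule: nesting_le.induct) auto

text \<open>Only \<open>copy\<close> lengthens a path. The symbol \<open>g\<close> it adds lies
  below some \<open>f\<close> that is \<open>m\<close> or not above \<open>m\<close>, so
  \<open>g\<close> is neither \<open>m\<close> nor above \<open>m\<close>.\<close>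

lemma nesting_le_star_step:
  assumes "irreflp lt" and "transp lt"
  assumes "star_step lt s t" and "nesting_le lt m n s"
  shows "nesting_le lt m n t"
  using assms(3,4)
proof (induction arbitrary: n rule: star_step.induct)
  case (copy g f k xs)
  have "g \<noteq> m \<and> \<not> lt m g"
    using copy assms(1,2) by (auto split: if_splits dest: transpD irreflpD)
  \<comment> \<open>Only the new root is unfolded, so that its subtrees match the assumption on the
    starred tree.\<close>
  with copy show ?case
    by (auto simp del: nesting_le_Node simp: nesting_le_Node[of _ _ _ "Plain g"])
qed (auto split: if_splits intro: nesting_le_Suc)

text \<open>Only the topmost occurrences of \<open>d\<close> matter. A tree without \<open>d\<close>
  qualifies for every \<open>n\<close>, however deeply it nests \<open>m\<close>.\<close>

inductive nesting_below :: "('a \<Rightarrow> 'a \<Rightarrow> bool) \<Rightarrow> 'a \<Rightarrow> 'a \<Rightarrow> nat \<Rightarrow> 'a starred tree \<Rightarrow> bool"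
  for lt :: "'a \<Rightarrow> 'a \<Rightarrow> bool" and d m :: 'a and n :: nat where
  at: "unstar h = d \<Longrightarrow> (\<forall>t \<in># ts. nesting_le lt m n t) \<Longrightarrow> nesting_below lt d m n (Node h ts)"
| above: "unstar h \<noteq> d \<Longrightarrow> (\<forall>t \<in># ts. nesting_below lt d m n t) \<Longrightarrow>
    nesting_below lt d m n (Node h ts)"

lemma nesting_below_Node [simp]:
  "nesting_below lt d m n (Node h ts) \<longleftrightarrow>
    (if unstar h = d then \<forall>t \<in># ts. nesting_le lt m n t
     else \<forall>t \<in># ts. nesting_below lt d m n t)"
  by (subst nesting_below.simps) auto

text \<open>The bounds \<open>k\<close> and \<open>n\<close> are unrelated: as \<open>d\<close> is
  above \<open>m\<close>, it cannot occur in \<open>t\<close>.\<close>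

lemma nesting_le_imp_below:
  assumes "irreflp lt" and "lt m d"
  shows "nesting_le lt m k t \<Longrightarrow> nesting_below lt d m n t"
  by (induction rule: nesting_le.induct) (use assms in \<open>auto dest: irreflpD\<close>)

lemma nesting_below_star_step:
  assumes "irreflp lt" and "transp lt" and "lt m d" and max: "\<And>a. \<not> lt d a"
  assumes "star_step lt s t" and "nesting_below lt d m n s"
  shows "nesting_below lt d m n t"
  using assms(5,6)
proof (induction rule: star_step.induct)
  case (select f y xs)
  then show ?case
    \<comment> \<open>If \<open>f = d\<close>, the selected \<open>y\<close> leaves the scope of
      \<open>d\<close>, but is itself free of \<open>d\<close>.\<close>
    using nesting_le_imp_below[OF assms(1,3)] by (auto split: if_splits)
next
  case (copy g f k xs)
  then have "g \<noteq> d"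
    using max by auto
  with copy show ?case
    by (auto simp del: nesting_below_Node simp: nesting_below_Node[of _ _ _ _ "Plain g"])
next
  case (subtree s t h xs)
  then show ?case
    \<comment> \<open>If \<open>h = d\<close>, the step happens below \<open>d\<close>, where
      \<open>nesting_le\<close> is the invariant.\<close>
    using nesting_le_star_step[OF assms(1,2) subtree.hyps] by (auto split: if_splits)
qed (auto split: if_splits)

lemma Star_rel_rtrancl_invariant:
  assumes "(s, t) \<in> (Star_rel lt)\<^sup>*" and "P s"
    and "\<And>u v. star_step lt u v \<Longrightarrow> P u \<Longrightarrow> P v"
  shows "P t"
  using assms(1,2) by induction (auto simp: Star_rel_def intro: assms(3))

theorem lemma6p8:
  fixes lt :: "lab \<Rightarrow> lab \<Rightarrow> bool"
  assumes "irreflp lt" and "transp lt" and "wfp lt"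
    and "\<And>a b. ord_less a b \<Longrightarrow> lt a b"
  shows "\<not> map_prod (map_tree Plain) (map_tree Plain) ` BH \<subseteq> (Star_rel lt)\<^sup>*"
proof
  let ?C = "[(Dagger, {#})]" and ?D = "[(Omega, {#})]"
  \<comment> \<open>The closest ancestor of the leaf 1 with label at most 1 is the 0 above
    \<open>Omega\<close>. Its relabelled copy again has label 0, since the leaf has label 1.\<close>
  let ?s = "fill (?C @ (Num 0, {#}) # ?D) (leaf (Num (Suc 0)))"
  let ?t = "fill (?C @ (Num 0, {#}) # ?D) (fill ((Num 0, {#}) # ?D) (leaf (Num 0)))"
  assume "map_prod (map_tree Plain) (map_tree Plain) ` BH \<subseteq> (Star_rel lt)\<^sup>*"
  moreover have "bh_step ?s ?t"
    by (rule bh2) (auto simp: ord_le_def)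
  then have "(?s, ?t) \<in> BH"
    by (auto simp: BH_def hydra_def)
  ultimately have steps: "(map_tree Plain ?s, map_tree Plain ?t) \<in> (Star_rel lt)\<^sup>*"
    by force
  have num_less: "lt (Num n) Omega" for n
    by (rule assms(4)) simp
  have not_less: "\<not> lt Omega (Num n)" "\<not> lt Omega Omega" for n
    using num_less[of n] assms(1,2) by (auto dest: transpD irreflpD)
  show False
  proof (cases "lt Omega Dagger")
    \<comment> \<open>Here \<open>Dagger\<close> may be incomparable to \<open>Omega\<close>, which
      \<open>nesting_le\<close> permits.\<close>
    case False
    have "nesting_le lt Omega 1 (map_tree Plain ?s)"
      using False not_less by simp
    then have "nesting_le lt Omega 1 (map_tree Plain ?t)"
      by (rule Star_rel_rtrancl_invariant[where P = "nesting_le lt Omega 1", OF steps])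
        (rule nesting_le_star_step[OF assms(1,2)])
    then show False
      by simp
  next
    case True
    \<comment> \<open>Every label is \<open>Dagger\<close> or at most \<open>Omega\<close>, hence
      below \<open>Dagger\<close> or equal to it; a label above \<open>Dagger\<close> would close a
      cycle.\<close>
    have max: "\<not> lt Dagger a" for a
    proof
      assume "lt Dagger a"
      with True num_less not_less assms(1,2) show False
        by (cases a) (blast dest: transpD irreflpD)+
    qed
    have "nesting_below lt Dagger Omega 1 (map_tree Plain ?s)"
      using not_less by simp
    then have "nesting_below lt Dagger Omega 1 (map_tree Plain ?t)"
      by (rule Star_rel_rtrancl_invariant[where P = "nesting_below lt Dagger Omega 1", OF steps])
        (rule nesting_below_star_step[OF assms(1,2) True max])
    then show False
      by simp
  qed
qed

end
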